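(* For every integer $n\ge 1$ and every subset $S\subseteq[n-1]$, (i) $\kappa^{\circ}_n(S)=|\mathrm{Bur}(S)[n]|=|\mathrm{Mat}(S)[n]|$; (ii) $\kappa_n(S)=|\mathrm{Bur}^{01}(S)[n]|=|\mathrm{Mat}^{01}(S)[n]|$; (iii) $\alpha_n(S)=|\mathrm{Bur}^{!}(S)[n]|=|\mathrm{Mat}^{!}(S)[n]|$.
   Context: Let $[n]=\{1,\dots,n\}$. A Cayley permutation on $[n]$ is a map $v:[n]\to[n]$ with image $[k]$ for some $k\le n$. $\mathrm{Cay}[n]$ is the set of Cayley permutations on $[n]$, $\mathrm{Sym}[n]$ the set of permutations of $[n]$, and $\mathrm{I}[n]$ the set of weakly increasing Cayley permutations on $[n]$. For a word $v$ of length $n$: $D(v)=\{i\in[n-1]: v(i)\ge v(i+1)\}$, $D^{\circ}(v)=\{i\in[n-1]: v(i)>v(i+1)\}$, $A(v)=\{i\in[n-1]: v(i)\le v(i+1)\}$ (weak ascents), $A^{\circ}(v)=\{i\in[n-1]: v(i)<v(i+1)\}$ (strict ascents). For $S\subseteq[n-1]$ put $\alpha_n(S)=|\{v\in\mathrm{Sym}[n]: A(v)\subseteq S\}|$, $\kappa_n(S)=|\{v\in\mathrm{Cay}[n]: A(v)\subseteq S\}|$, $\kappa^{\circ}_n(S)=|\{v\in\mathrm{Cay}[n]: A^{\circ}(v)\subseteq S\}|$. Write $S=\{s_1<s_2<\dots<s_r\}$. Let $\eta(S)=1^{s_1}2^{s_2-s_1}\cdots r^{s_r-s_{r-1}}(r+1)^{n-s_r}$,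 the unique element of $\mathrm{I}[n]$ with $D(\eta(S))=[n-1]\setminus S$, and let $\Delta(S)=(s_1,s_2-s_1,\dots,s_r-s_{r-1},n-s_r)$ (so $\eta(\emptyset)=1^n$, $\Delta(\emptyset)=(n)$). $\mathrm{Bur}[n]=\{(u,v)\in\mathrm{I}[n]\times\mathrm{Cay}[n]: D(u)\subseteq D(v)\}$, $\mathrm{Bur}^{01}[n]=\{(u,v)\in\mathrm{Bur}[n]: D(u)\subseteq D^{\circ}(v)\}$, $\mathrm{Bur}^{!}[n]=\{(u,v)\in\mathrm{Bur}[n]: v\in\mathrm{Sym}[n]\}$. The sets $\mathrm{Bur}(S)[n]$, $\mathrm{Bur}^{01}(S)[n]$, $\mathrm{Bur}^{!}(S)[n]$ consist of the elements $(u,v)$ of $\mathrm{Bur}[n]$, $\mathrm{Bur}^{01}[n]$, $\mathrm{Bur}^{!}[n]$, respectively, with $u=\eta(S)$. $\mathrm{Mat}[n]$ is the set of matrices with nonnegative integer entries summing to $n$ in which every row and every column has at least one nonzero entry. $\mathrm{Mat}(S)[n]$ is the set of $A\in\mathrm{Mat}[n]$ whose vector of row sums equals $\Delta(S)$; $\mathrm{Mat}^{01}(S)[n]$ is the subset of those with all entries in $\{0,1\}$; $\mathrm{Mat}^{!}(S)[n]$ is the subset of those in which every column sums to $1$. *)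

theory Defs
  imports "Jordan_Normal_Form.Matrix" "HOL-Combinatorics.Multiset_Permutations"
begin

text \<open>
  A map from \<open>{1..n}\<close> to \<open>{1..n}\<close> is the word (list) of its \<open>n\<close> values. Letters and positions are
  counted from 1 but lists are indexed from 0, so the letter \<open>v(i)\<close> is \<open>v ! (i - 1)\<close> and
  \<open>v(i+1)\<close> is \<open>v ! i\<close>.
\<close>

definition Cay :: "nat \<Rightarrow> nat list set" where
  "Cay n = {v. length v = n \<and> set v \<subseteq> {1..n} \<and> (\<exists>k\<le>n. set v = {1..k})}"

definition Sym :: "nat \<Rightarrow> nat list set" where
  "Sym n = permutations_of_set {1..n}"

definition IncCay :: "nat \<Rightarrow> nat list set" where
  "IncCay n = {v \<in> Cay n. sorted v}"

definition weak_descents :: "nat list \<Rightarrow> nat set" where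
  "weak_descents v = {i \<in> {1..length v - 1}. v ! (i - 1) \<ge> v ! i}"

definition strict_descents :: "nat list \<Rightarrow> nat set" where
  "strict_descents v = {i \<in> {1..length v - 1}. v ! (i - 1) > v ! i}"

definition weak_ascents :: "nat list \<Rightarrow> nat set" where
  "weak_ascents v = {i \<in> {1..length v - 1}. v ! (i - 1) \<le> v ! i}"

definition strict_ascents :: "nat list \<Rightarrow> nat set" where
  "strict_ascents v = {i \<in> {1..length v - 1}. v ! (i - 1) < v ! i}"

definition alpha :: "nat \<Rightarrow> nat set \<Rightarrow> nat" where
  "alpha n S = card {v \<in> Sym n. weak_ascents v \<subseteq> S}"

definition kappa :: "nat \<Rightarrow> nat set \<Rightarrow> nat" where
  "kappa n S = card {v \<in> Cay n. weak_ascents v \<subseteq> S}"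

definition kappa_strict :: "nat \<Rightarrow> nat set \<Rightarrow> nat" where
  "kappa_strict n S = card {v \<in> Cay n. strict_ascents v \<subseteq> S}"

text \<open>
  For \<open>S = {s\<^sub>1 < \<dots> < s\<^sub>r}\<close> the composition below is
  \<open>[s\<^sub>1 - 0, s\<^sub>2 - s\<^sub>1, \<dots>, s\<^sub>r - s\<^bsub>r-1\<^esub>, n - s\<^sub>r]\<close>, which is \<open>[n]\<close> for empty \<open>S\<close>.
  The \<open>i\<close>-th part is the number of copies of the letter \<open>i\<close> in \<open>eta n S\<close>, for \<open>i = 1, \<dots>, r + 1\<close>.
\<close>

definition Delta :: "nat \<Rightarrow> nat set \<Rightarrow> nat list" where
  "Delta n S = map2 (-) (sorted_list_of_set S @ [n]) (0 # sorted_list_of_set S)"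

definition eta :: "nat \<Rightarrow> nat set \<Rightarrow> nat list" where
  "eta n S = concat (map2 replicate (Delta n S) [1..<Suc (length (Delta n S))])"

definition Bur :: "nat \<Rightarrow> (nat list \<times> nat list) set" where
  "Bur n = {(u, v) \<in> IncCay n \<times> Cay n. weak_descents u \<subseteq> weak_descents v}"

definition Bur01 :: "nat \<Rightarrow> (nat list \<times> nat list) set" where
  "Bur01 n = {(u, v) \<in> Bur n. weak_descents u \<subseteq> strict_descents v}"

definition BurSym :: "nat \<Rightarrow> (nat list \<times> nat list) set" where
  "BurSym n = {(u, v) \<in> Bur n. v \<in> Sym n}"

definition Bur_at :: "nat \<Rightarrow> nat set \<Rightarrow> (nat list \<times> nat list) set" where
  "Bur_at n S = {(u, v) \<in> Bur n. u = eta n S}"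

definition Bur01_at :: "nat \<Rightarrow> nat set \<Rightarrow> (nat list \<times> nat list) set" where
  "Bur01_at n S = {(u, v) \<in> Bur01 n. u = eta n S}"

definition BurSym_at :: "nat \<Rightarrow> nat set \<Rightarrow> (nat list \<times> nat list) set" where
  "BurSym_at n S = {(u, v) \<in> BurSym n. u = eta n S}"

definition row_sums :: "nat mat \<Rightarrow> nat list" where
  "row_sums A = map (\<lambda>i. \<Sum>j<dim_col A. A $$ (i, j)) [0..<dim_row A]"

definition Mat :: "nat \<Rightarrow> nat mat set" where
  "Mat n = {A. (\<Sum>i<dim_row A. \<Sum>j<dim_col A. A $$ (i, j)) = n \<and>
               (\<forall>i<dim_row A. \<exists>j<dim_col A. A $$ (i, j) \<noteq> 0) \<and>
               (\<forall>j<dim_col A. \<exists>i<dim_row A. A $$ (i, j) \<noteq> 0)}"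

definition Mat_at :: "nat \<Rightarrow> nat set \<Rightarrow> nat mat set" where
  "Mat_at n S = {A \<in> Mat n. row_sums A = Delta n S}"

definition Mat01_at :: "nat \<Rightarrow> nat set \<Rightarrow> nat mat set" where
  "Mat01_at n S = {A \<in> Mat_at n S. elements_mat A \<subseteq> {0, 1}}"

definition MatSym_at :: "nat \<Rightarrow> nat set \<Rightarrow> nat mat set" where
  "MatSym_at n S = {A \<in> Mat_at n S. \<forall>j<dim_col A. (\<Sum>i<dim_row A. A $$ (i, j)) = 1}"

end

theory Submission
  imports Defs
begin

text \<open>
  Fix \<open>S\<close> and cut a word of length \<open>n\<close> after each position in \<open>S\<close>; the blocks have the lengths
  \<open>Delta n S\<close>. A position outside \<open>S\<close> lies strictly inside a block, so a condition on neighbouring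
  letters at all positions outside \<open>S\<close> is a condition on the separate blocks: for a transitive
  relation, each block is sorted (lemma \<open>sorted_wrt_blocks_iff\<close>).

  Since \<open>eta n S\<close> is constant exactly on the blocks, its weak descents are the positions outside
  \<open>S\<close>. An element of \<open>Bur_at n S\<close> is thus a Cayley permutation with a weak descent everywhere
  outside \<open>S\<close>, which says that its strict ascents lie in \<open>S\<close>. The same complementation turns the
  strict version into the condition that weak ascents lie in \<open>S\<close>, and for a permutation the two
  versions agree. This gives the first equality of each part.

  For the matrices, let row \<open>i\<close> record the multiplicities of the letters in block \<open>i\<close>. A weakly
  decreasing block is determined by its multiplicities, so this is a bijection between the words
  whose blocks decrease weakly and the matrices with row sums \<open>Delta n S\<close>. The inverse, which spells
  out every row with the largest letter first, is \<open>reading_word\<close>. No row of such a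
  matrix vanishes, as the parts of \<open>Delta n S\<close> are positive, and no column vanishes iff every column
  number, as a letter, occurs in the word; the word is then a Cayley permutation.
  Under this bijection the entries are at most 1 iff every block decreases strictly, and the
  column sums are 1 iff every letter occurs once, that is, iff the word is a permutation. The second equalities are the resulting restrictions of one bijection
  (lemmas \<open>bij_betw_reading_word\<close>, \<open>entries01_iff\<close> and \<open>column_sums_1_iff\<close>).
\<close>

section \<open>Cutting a word into blocks\<close>

text \<open>
  The composition of a list of cut points is treated with an arbitrary left end \<open>a\<close> in place
  of 0, because removing the first block moves the left end to the first cut point. The letter at
  position \<open>p\<close> of a word starting after position \<open>a\<close> has the list index \<open>p - Suc a\<close>.
\<close>

lemma sum_list_gaps:
  fixes a n :: nat
  assumes "sorted (a # xs @ [n])"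
  shows "sum_list (map2 (-) (xs @ [n]) (a # xs)) = n - a"
  using assms
proof (induction xs arbitrary: a)
  case (Cons x xs)
  then have "a \<le> x" "x \<le> n" by auto
  with Cons show ?case by simp
qed simp

lemma gaps_pos:
  fixes a n :: nat
  assumes "sorted_wrt (<) (a # xs @ [n])" "d \<in> set (map2 (-) (xs @ [n]) (a # xs))"
  shows "0 < d"
  using assms by (induction xs arbitrary: a) auto

lemma sorted_wrt_block_iff:
  fixes a x :: nat
  assumes "transp R" "length b = x - a"
  shows "sorted_wrt R b \<longleftrightarrow> (\<forall>p. a < p \<and> p < x \<longrightarrow> R (b ! (p - Suc a)) (b ! (p - a)))"
  unfolding sorted_wrt_iff_nth_Suc_transp[OF assms(1)] assms(2)
proof safe
  fix p assume "\<forall>i. Suc i < x - a \<longrightarrow> R (b ! i) (b ! Suc i)" "a < p" "p < x"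
  then show "R (b ! (p - Suc a)) (b ! (p - a))" by (auto dest!: spec[of _ "p - Suc a"] simp: Suc_diff_Suc)
next
  fix i assume "\<forall>p. a < p \<and> p < x \<longrightarrow> R (b ! (p - Suc a)) (b ! (p - a))" "Suc i < x - a"
  then show "R (b ! i) (b ! Suc i)" by (auto dest!: spec[of _ "Suc i + a"])
qed

text \<open>
  At a position that is not a cut point, the two neighbouring letters belong to the same block, and
  sortedness for a transitive relation is a condition on neighbours.
\<close>

lemma sorted_wrt_blocks_iff:
  fixes a n :: nat
  assumes "transp R" "sorted (a # xs @ [n])"
    and "map length bs = map2 (-) (xs @ [n]) (a # xs)"
  shows "(\<forall>b\<in>set bs. sorted_wrt R b) \<longleftrightarrow>
    (\<forall>p. a < p \<and> p < n \<and> p \<notin> set xs \<longrightarrow> R (concat bs ! (p - Suc a)) (concat bs ! (p - a)))"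
  using assms(2,3)
proof (induction xs arbitrary: a bs)
  case Nil
  then obtain b where b: "bs = [b]" "length b = n - a" by (auto simp: map_eq_Cons_conv)
  show ?case using sorted_wrt_block_iff[OF assms(1) b(2)] by (simp add: b(1))
next
  case (Cons x xs)
  then obtain b bs' where b: "bs = b # bs'" "length b = x - a"
    "map length bs' = map2 (-) (xs @ [n]) (x # xs)" by (auto simp: map_eq_Cons_conv)
  have le: "a \<le> x" "x \<le> n" "\<forall>y\<in>set xs. x \<le> y" using Cons.prems by auto
  have IH: "(\<forall>c\<in>set bs'. sorted_wrt R c) \<longleftrightarrow>
    (\<forall>p. x < p \<and> p < n \<and> p \<notin> set xs \<longrightarrow> R (concat bs' ! (p - Suc x)) (concat bs' ! (p - x)))"
    using Cons.IH[of x bs'] Cons.prems(1) b(3) by simp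
  have head: "sorted_wrt R b \<longleftrightarrow>
    (\<forall>p. a < p \<and> p < x \<longrightarrow> R (concat bs ! (p - Suc a)) (concat bs ! (p - a)))"
  proof -
    have "concat bs ! (p - Suc a) = b ! (p - Suc a) \<and> concat bs ! (p - a) = b ! (p - a)"
      if "a < p" "p < x" for p
    proof -
      have "p - Suc a < x - a" "p - a < x - a" using that by linarith+
      then show ?thesis using b(1,2) by (simp add: nth_append)
    qed
    then show ?thesis unfolding sorted_wrt_block_iff[OF assms(1) b(2)] by auto
  qed
  have tail: "concat bs ! (p - Suc a) = concat bs' ! (p - Suc x)"
      "concat bs ! (p - a) = concat bs' ! (p - x)" if "x < p" for p
    using that b le(1) by (auto simp: nth_append)
  have "(\<forall>p. a < p \<and> p < n \<and> p \<notin> set (x # xs) \<longrightarrow>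
      R (concat bs ! (p - Suc a)) (concat bs ! (p - a))) \<longleftrightarrow>
    (\<forall>p. a < p \<and> p < x \<longrightarrow> R (concat bs ! (p - Suc a)) (concat bs ! (p - a))) \<and>
    (\<forall>p. x < p \<and> p < n \<and> p \<notin> set xs \<longrightarrow> R (concat bs ! (p - Suc a)) (concat bs ! (p - a)))"
    (is "?l = (?r1 \<and> ?r2)")
  proof (intro iffI conjI allI impI; (elim conjE)?)
    fix p assume h: ?l "a < p" "p < x"
    then show "R (concat bs ! (p - Suc a)) (concat bs ! (p - a))" using le by fastforce
  next
    fix p assume h: ?l "x < p" "p < n" "p \<notin> set xs"
    then show "R (concat bs ! (p - Suc a)) (concat bs ! (p - a))" using le by auto
  next
    fix p assume h: ?r1 ?r2 "a < p" "p < n" "p \<notin> set (x # xs)"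
    then show "R (concat bs ! (p - Suc a)) (concat bs ! (p - a))" by (cases "p < x") auto
  qed
  also have "\<dots> \<longleftrightarrow> sorted_wrt R b \<and> (\<forall>c\<in>set bs'. sorted_wrt R c)"
    unfolding head IH using tail by auto
  finally show ?case by (simp add: b(1))
qed

lemma exists_blocks:
  assumes "length w = sum_list ds"
  obtains bs where "concat bs = w" "map length bs = ds"
  using assms
proof (induction ds arbitrary: w thesis)
  case (Cons d ds)
  obtain bs where "concat bs = drop d w" "map length bs = ds"
    using Cons.IH[of "drop d w"] Cons.prems(2) by auto
  then show ?case using Cons.prems(2) by (intro Cons.prems(1)[of "take d w # bs"]) auto
qed simp

lemma map_length_letter_runs:
  "map length (map2 replicate ds [c..<c + length ds]) = ds"
  by (rule nth_equalityI) (auto simp del: upt_Suc)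

text \<open>
  Letters are constant within a run and increase from each run to the next, so a strict ascent
  occurs exactly where a new run starts.
\<close>

lemma weak_descents_letter_runs:
  fixes a n c :: nat
  assumes "sorted (a # xs @ [n])"
  defines "ds \<equiv> map2 (-) (xs @ [n]) (a # xs)"
  defines "w \<equiv> concat (map2 replicate ds [c..<c + length ds])"
  assumes "a < p" "p < n"
  shows "w ! (p - a) \<le> w ! (p - Suc a) \<longleftrightarrow> p \<notin> set xs"
  using assms(1,4) unfolding w_def ds_def
proof (induction xs arbitrary: a c)
  case Nil
  then show ?case using assms(5) by simp
next
  case (Cons x xs)
  let ?ds = "map2 (-) (xs @ [n]) (x # xs)"
  let ?w = "concat (map2 replicate ?ds [Suc c..<Suc c + length ?ds])"
  have lt: "a \<le> x" "x \<le> n" "\<forall>y\<in>set xs. x \<le> y" using Cons.prems by auto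
  have split: "concat (map2 replicate (map2 (-) ((x # xs) @ [n]) (a # x # xs))
      [c..<c + length (map2 (-) ((x # xs) @ [n]) (a # x # xs))]) = replicate (x - a) c @ ?w"
    by (simp add: upt_rec[of c] del: upt_Suc)
  have IH: "x < p \<Longrightarrow> ?w ! (p - x) \<le> ?w ! (p - Suc x) \<longleftrightarrow> p \<notin> set xs"
    using Cons.IH[of x "Suc c"] Cons.prems(1) by simp
  have "length ?w = sum_list ?ds" by (simp only: length_concat map_length_letter_runs)
  also have "\<dots> = n - x"
    by (rule sum_list_gaps) (use Cons.prems(1) in auto)
  finally have len: "length ?w = n - x" .
  have big: "\<forall>y\<in>set ?w. c < y" by (auto simp: set_zip simp del: upt_Suc)
  consider "p < x" | "p = x" | "x < p" by linarith
  then show ?case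
  proof cases
    case 1
    then show ?thesis unfolding split using lt Cons.prems by (auto simp: nth_append)
  next
    case 2
    have "?w ! 0 \<in> set ?w" using len 2 assms(5) by (intro nth_mem) auto
    with 2 big show ?thesis unfolding split using lt Cons.prems by (auto simp: nth_append not_le)
  next
    case 3
    then show ?thesis unfolding split using lt IH by (auto simp: nth_append)
  qed
qed

lemma sorted_letter_runs:
  "sorted (concat (map2 replicate ds [c..<c + length ds]))"
proof (induction ds arbitrary: c)
  case (Cons d ds)
  show ?case using Cons[of "Suc c"]
    by (auto simp: upt_rec[of c] sorted_append set_zip simp del: upt_Suc)
qed simp

section \<open>Burge words as descent classes of Cayley permutations\<close>

locale cut_set =
  fixes n :: nat and S :: "nat set"
  assumes n_pos: "n \<ge> 1" and S_sub: "S \<subseteq> {1..n - 1}"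
begin

abbreviation "cuts \<equiv> sorted_list_of_set S"

lemma set_cuts: "set cuts = S"
  using S_sub by (simp add: finite_subset)

lemma strict_sorted_cuts: "sorted_wrt (<) (0 # cuts @ [n])"
  using S_sub n_pos by (force simp: sorted_wrt_append set_cuts)

lemma sorted_cuts: "sorted (0 # cuts @ [n])"
  using strict_sorted_cuts by (simp add: strict_sorted_iff)

lemma sum_Delta: "sum_list (Delta n S) = n"
  using sum_list_gaps[OF sorted_cuts] by (simp add: Delta_def)

lemma Delta_pos: "d \<in> set (Delta n S) \<Longrightarrow> 0 < d"
  using gaps_pos[OF strict_sorted_cuts] by (simp add: Delta_def)

lemma sorted_wrt_Delta_blocks_iff:
  assumes "transp R" "map length bs = Delta n S"
  shows "(\<forall>b\<in>set bs. sorted_wrt R b) \<longleftrightarrow>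
    (\<forall>p\<in>{1..n - 1} - S. R (concat bs ! (p - 1)) (concat bs ! p))"
  using sorted_wrt_blocks_iff[OF assms(1) sorted_cuts, of bs] assms(2)
  by (auto simp: Delta_def set_cuts)

lemma length_concat_Delta:
  assumes "map length bs = Delta n S"
  shows "length (concat bs) = n"
  using assms sum_Delta by (simp add: length_concat)

lemma length_eta: "length (eta n S) = n"
  using length_concat_Delta[OF map_length_letter_runs[of _ 1]] by (simp add: eta_def)

lemma weak_descents_eta: "weak_descents (eta n S) = {1..n - 1} - S"
proof -
  have "eta n S ! p \<le> eta n S ! (p - 1) \<longleftrightarrow> p \<notin> S" if "0 < p" "p < n" for p
    using weak_descents_letter_runs[OF sorted_cuts that, of 1]
    by (simp add: eta_def Delta_def set_cuts del: upt_Suc)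
  then show ?thesis by (auto simp: weak_descents_def length_eta)
qed

lemma eta_IncCay: "eta n S \<in> IncCay n"
proof -
  have set: "set (eta n S) = {1..length (Delta n S)}"
  proof -
    have "i \<in> set (eta n S)" if i: "i \<in> {1..length (Delta n S)}" for i
    proof -
      have "0 < Delta n S ! (i - 1)" using i by (intro Delta_pos nth_mem) auto
      then have "i \<in> set (replicate (Delta n S ! (i - 1)) i)" by simp
      moreover have "(Delta n S ! (i - 1), i) \<in> set (zip (Delta n S) [1..<Suc (length (Delta n S))])"
        using i by (auto simp: set_zip simp del: upt_Suc intro!: exI[of _ "i - 1"])
      ultimately show ?thesis unfolding eta_def set_concat set_map by blast
    qed
    then show ?thesis by (auto simp: eta_def set_zip simp del: upt_Suc)
  qed
  have "card (set (eta n S)) \<le> n" using card_length[of "eta n S"] length_eta by simp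
  then have "length (Delta n S) \<le> n" using set by simp
  moreover have "sorted (eta n S)" using sorted_letter_runs[of "Delta n S" 1] by (simp add: eta_def)
  ultimately show ?thesis using set length_eta by (auto simp: IncCay_def Cay_def)
qed

text \<open>
  As the first component of each pair is fixed, the three sets of pairs are copies of sets of
  words, which are determined by the positions outside \<open>S\<close>.
\<close>

lemma Bur_at_eq:
  "Bur_at n S = Pair (eta n S) ` {v \<in> Cay n. {1..n - 1} - S \<subseteq> weak_descents v}"
  using eta_IncCay by (auto simp: Bur_at_def Bur_def weak_descents_eta)

lemma strict_subset_weak_descents: "strict_descents v \<subseteq> weak_descents v"
  by (auto simp: strict_descents_def weak_descents_def)

lemma Bur01_at_eq:
  "Bur01_at n S = Pair (eta n S) ` {v \<in> Cay n. {1..n - 1} - S \<subseteq> strict_descents v}"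
  using eta_IncCay strict_subset_weak_descents
  by (fastforce simp: Bur01_at_def Bur01_def Bur_def weak_descents_eta)

lemma Sym_subset_Cay: "Sym n \<subseteq> Cay n"
  by (auto simp: Sym_def Cay_def permutations_of_set_def distinct_card[symmetric])

lemma BurSym_at_eq:
  "BurSym_at n S = Pair (eta n S) ` {v \<in> Sym n. {1..n - 1} - S \<subseteq> weak_descents v}"
  using eta_IncCay Sym_subset_Cay by (auto simp: BurSym_at_def BurSym_def Bur_def weak_descents_eta)

text \<open>
  Strict ascents and weak descents are complementary, and so are weak ascents and strict descents.
\<close>

lemma strict_ascents_subset_iff:
  "length v = n \<Longrightarrow> strict_ascents v \<subseteq> S \<longleftrightarrow> {1..n - 1} - S \<subseteq> weak_descents v"
  by (force simp: strict_ascents_def weak_descents_def not_le)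

lemma weak_ascents_subset_iff:
  "length v = n \<Longrightarrow> weak_ascents v \<subseteq> S \<longleftrightarrow> {1..n - 1} - S \<subseteq> strict_descents v"
  by (force simp: weak_ascents_def strict_descents_def not_le)

end

lemma weak_descents_distinct:
  assumes "distinct v"
  shows "weak_descents v = strict_descents v"
proof -
  have "v ! (i - 1) \<noteq> v ! i" if "i \<in> {1..length v - 1}" for i
    using that assms by (auto simp: nth_eq_iff_index_eq)
  then show ?thesis unfolding weak_descents_def strict_descents_def by (metis less_le)
qed

section \<open>The reading word of a matrix\<close>

text \<open>
  Column \<open>j\<close> stands for the letter \<open>Suc j\<close>. The columns are read from right to left, so that
  the word of a row decreases weakly.
\<close>

definition row_word :: "nat mat \<Rightarrow> nat \<Rightarrow> nat list" where
  "row_word A i = concat (map (\<lambda>j. replicate (A $$ (i, j)) (Suc j)) (rev [0..<dim_col A]))"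

definition reading_word :: "nat mat \<Rightarrow> nat list" where
  "reading_word A = concat (map (row_word A) [0..<dim_row A])"

lemma count_decreasing_runs:
  "count (mset (concat (map (\<lambda>j. replicate (f j) (Suc j)) (rev [0..<k])))) (Suc j) =
     (if j < k then f j else 0)"
  by (induction k) (auto simp: less_Suc_eq)

lemma sorted_decreasing_runs:
  "sorted_wrt (\<ge>) (concat (map (\<lambda>j. replicate (f j) (Suc j)) (rev [0..<k])))"
proof (induction k)
  case (Suc k)
  have "sorted_wrt (\<ge>) (replicate m x)" for m and x :: nat
    by (induction m) auto
  with Suc show ?case by (auto simp: sorted_wrt_append)
qed simp

lemma count_row_word: "count (mset (row_word A i)) (Suc j) = (if j < dim_col A then A $$ (i, j) else 0)"
  unfolding row_word_def by (rule count_decreasing_runs)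

lemma sorted_row_word: "sorted_wrt (\<ge>) (row_word A i)"
  unfolding row_word_def by (rule sorted_decreasing_runs)

lemma zero_notin_row_word: "0 \<notin> set (row_word A i)"
  by (auto simp: row_word_def)

lemma map_length_row_words: "map length (map (row_word A) [0..<dim_row A]) = row_sums A"
proof -
  have "length (row_word A i) = (\<Sum>j<dim_col A. A $$ (i, j))" for i
    unfolding row_word_def
    by (simp add: length_concat comp_def rev_map[symmetric] sum_list_rev
        interv_sum_list_conv_sum_set_nat atLeast0LessThan)
  then show ?thesis by (simp add: row_sums_def)
qed

lemma count_reading_word:
  "count (mset (reading_word A)) (Suc j) = (if j < dim_col A then \<Sum>i<dim_row A. A $$ (i, j) else 0)"
proof -
  have "count (mset (concat (map f [0..<m]))) x = (\<Sum>i<m. count (mset (f i)) x)"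
    for f :: "nat \<Rightarrow> nat list" and m x
    by (induction m) auto
  then show ?thesis by (simp add: reading_word_def count_row_word)
qed

lemma Suc_in_reading_word_iff:
  "Suc j \<in> set (reading_word A) \<longleftrightarrow> j < dim_col A \<and> (\<exists>i<dim_row A. A $$ (i, j) \<noteq> 0)"
proof -
  have "Suc j \<in> set (reading_word A) \<longleftrightarrow> count (mset (reading_word A)) (Suc j) \<noteq> 0"
    by (simp add: count_eq_zero_iff)
  also have "\<dots> \<longleftrightarrow> j < dim_col A \<and> \<not> (\<forall>i\<in>{..<dim_row A}. A $$ (i, j) = 0)"
    by (simp add: count_reading_word del: neq0_conv)
  finally show ?thesis by auto
qed

lemma zero_notin_reading_word: "0 \<notin> set (reading_word A)"
  by (auto simp: reading_word_def zero_notin_row_word)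

lemma set_reading_word:
  assumes "\<forall>j<dim_col A. \<exists>i<dim_row A. A $$ (i, j) \<noteq> 0"
  shows "set (reading_word A) = {1..dim_col A}"
proof (rule Set.set_eqI)
  fix x
  show "x \<in> set (reading_word A) \<longleftrightarrow> x \<in> {1..dim_col A}"
    using assms zero_notin_reading_word Suc_in_reading_word_iff
    by (cases x) (auto simp: Suc_le_eq)
qed

lemma weakly_decreasing_eqI:
  fixes xs ys :: "'a :: linorder list"
  assumes "sorted_wrt (\<ge>) xs" "sorted_wrt (\<ge>) ys" "mset xs = mset ys"
  shows "xs = ys"
proof -
  have "sorted (rev xs)" "sorted (rev ys)" using assms by (auto simp: sorted_wrt_rev)
  then have "rev xs = rev ys" using assms(3) by (metis mset_rev properties_for_sort)
  then show ?thesis by simp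
qed

lemma strictly_decreasing_iff:
  fixes xs :: "'a :: linorder list"
  shows "sorted_wrt (>) xs \<longleftrightarrow> sorted_wrt (\<ge>) xs \<and> distinct xs"
  using strict_sorted_iff[of "rev xs"] by (simp add: sorted_wrt_rev)

lemma distinct_iff_count_le: "distinct xs \<longleftrightarrow> (\<forall>x. count (mset xs) x \<le> 1)"
proof
  assume "distinct xs"
  then show "\<forall>x. count (mset xs) x \<le> 1" by (simp add: distinct_count_atmost_1)
next
  assume *: "\<forall>x. count (mset xs) x \<le> 1"
  have "count (mset xs) x = (if x \<in> set xs then 1 else 0)" for x
    using *[rule_format, of x] count_eq_zero_iff[of "mset xs" x] by (cases "count (mset xs) x") auto
  then show "distinct xs" unfolding distinct_count_atmost_1 by blast
qed

text \<open>
  The row sums tell where to cut the reading word, and the blocks then give the entries as letter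
  multiplicities. The number of columns is the number of distinct letters; without the hypothesis on
  columns, vanishing columns at the right end would leave no trace in the word.
\<close>

lemma reading_word_inj:
  assumes "row_sums A = row_sums B" "reading_word A = reading_word B"
    and "\<forall>j<dim_col A. \<exists>i<dim_row A. A $$ (i, j) \<noteq> 0"
    and "\<forall>j<dim_col B. \<exists>i<dim_row B. B $$ (i, j) \<noteq> 0"
  shows "A = B"
proof -
  let ?rows = "\<lambda>A. map (row_word A) [0..<dim_row A]"
  have dim_row: "dim_row A = dim_row B"
    using arg_cong[OF assms(1), of length] by (simp add: row_sums_def)
  have "card (set (reading_word A)) = card (set (reading_word B))" using assms(2) by simp
  then have dim_col: "dim_col A = dim_col B"
    by (simp add: set_reading_word[OF assms(3)] set_reading_word[OF assms(4)])
  have lens: "map length (?rows A) = map length (?rows B)"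
    using assms(1) by (simp only: map_length_row_words)
  have "?rows A = ?rows B"
  proof (rule concat_injective)
    show "concat (?rows A) = concat (?rows B)" using assms(2) by (simp add: reading_word_def)
    show "length (?rows A) = length (?rows B)" by (simp add: dim_row)
    show "\<forall>(x, y)\<in>set (zip (?rows A) (?rows B)). length x = length y"
      using lens by (auto simp: set_zip dim_row)
  qed
  then have "row_word A i = row_word B i" if "i < dim_row B" for i
    using that dim_row by auto
  then have "A $$ (i, j) = B $$ (i, j)" if "i < dim_row B" "j < dim_col B" for i j
    using that count_row_word[of A i j] count_row_word[of B i j] dim_col by simp
  then show ?thesis using dim_row dim_col by auto
qed

section \<open>Matrices with prescribed row sums\<close>

context cut_set
begin

text \<open>
  The row sums already determine the total, and no row vanishes because every part of the
  composition is positive.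
\<close>

lemma Mat_at_iff:
  "A \<in> Mat_at n S \<longleftrightarrow>
     row_sums A = Delta n S \<and> (\<forall>j<dim_col A. \<exists>i<dim_row A. A $$ (i, j) \<noteq> 0)"
proof -
  have "(\<Sum>i<dim_row A. \<Sum>j<dim_col A. A $$ (i, j)) = n" if "row_sums A = Delta n S"
  proof -
    have "sum_list (row_sums A) = (\<Sum>i<dim_row A. \<Sum>j<dim_col A. A $$ (i, j))"
      unfolding row_sums_def by (simp add: interv_sum_list_conv_sum_set_nat atLeast0LessThan)
    then show ?thesis using that sum_Delta by simp
  qed
  moreover have "\<exists>j<dim_col A. A $$ (i, j) \<noteq> 0" if "row_sums A = Delta n S" "i < dim_row A" for i
  proof -
    have "(\<Sum>j<dim_col A. A $$ (i, j)) \<in> set (row_sums A)" using that(2) by (auto simp: row_sums_def)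
    then have "0 < (\<Sum>j<dim_col A. A $$ (i, j))" using Delta_pos that(1) by simp
    then show ?thesis by (rule_tac ccontr) simp
  qed
  ultimately show ?thesis by (auto simp: Mat_at_def Mat_def)
qed

lemma length_reading_word:
  assumes "A \<in> Mat_at n S"
  shows "length (reading_word A) = n"
  using assms length_concat_Delta[of "map (row_word A) [0..<dim_row A]"] map_length_row_words[of A]
  by (simp add: Mat_at_iff reading_word_def)

lemma reading_word_Cay:
  assumes "A \<in> Mat_at n S"
  shows "reading_word A \<in> Cay n"
proof -
  have set: "set (reading_word A) = {1..dim_col A}"
    using assms by (intro set_reading_word) (auto simp: Mat_at_iff)
  then have "dim_col A \<le> n"
    using card_length[of "reading_word A"] length_reading_word[OF assms] by simp
  with set length_reading_word[OF assms] show ?thesis by (auto simp: Cay_def)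
qed

lemma sorted_rows_iff:
  assumes "A \<in> Mat_at n S" "transp R"
  shows "(\<forall>i<dim_row A. sorted_wrt R (row_word A i)) \<longleftrightarrow>
    (\<forall>p\<in>{1..n - 1} - S. R (reading_word A ! (p - 1)) (reading_word A ! p))"
  using sorted_wrt_Delta_blocks_iff[OF assms(2), of "map (row_word A) [0..<dim_row A]"]
    map_length_row_words[of A] assms(1)
  by (auto simp: Mat_at_iff reading_word_def)

text \<open>
  For surjectivity, cut a word into blocks and count letters. Each block decreases weakly, and so
  does the row word with the same letter multiplicities; hence they coincide.
\<close>

lemma bij_betw_reading_word:
  "bij_betw reading_word (Mat_at n S) {v \<in> Cay n. {1..n - 1} - S \<subseteq> weak_descents v}"
  (is "bij_betw _ _ ?W")
proof (rule bij_betw_imageI)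
  show "inj_on reading_word (Mat_at n S)"
    by (rule inj_onI, rule reading_word_inj) (auto simp: Mat_at_iff)
  have "reading_word A \<in> ?W" if A: "A \<in> Mat_at n S" for A
    using sorted_rows_iff[OF A, of "(\<ge>)"] sorted_row_word[of A] reading_word_Cay[OF A]
      length_reading_word[OF A]
    by (auto simp: weak_descents_def transp_def)
  moreover have "v \<in> reading_word ` Mat_at n S" if v: "v \<in> ?W" for v
  proof -
    have len: "length v = n" using v by (auto simp: Cay_def)
    obtain k where k: "set v = {1..k}" using v by (auto simp: Cay_def)
    obtain bs where bs: "concat bs = v" "map length bs = Delta n S"
      using exists_blocks[of v "Delta n S"] len sum_Delta by auto
    have "\<forall>p\<in>{1..n - 1} - S. v ! (p - 1) \<ge> v ! p"
      using v by (auto simp: weak_descents_def)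
    then have dec: "\<forall>b\<in>set bs. sorted_wrt (\<ge>) b"
      using sorted_wrt_Delta_blocks_iff[of "(\<ge>)" bs] bs by (simp add: transp_def)
    define A where "A = mat (length bs) k (\<lambda>(i, j). count (mset (bs ! i)) (Suc j))"
    have row: "row_word A i = bs ! i" if i: "i < length bs" for i
    proof (rule weakly_decreasing_eqI)
      have "set (bs ! i) \<subseteq> set (concat bs)" using nth_mem[OF i] by (simp add: UN_upper)
      then have sub: "set (bs ! i) \<subseteq> {1..k}" unfolding bs(1) k .
      show "mset (row_word A i) = mset (bs ! i)"
      proof (rule multiset_eqI)
        fix x
        show "count (mset (row_word A i)) x = count (mset (bs ! i)) x"
        proof (cases x)
          case 0
          then have "x \<notin> set (row_word A i)" "x \<notin> set (bs ! i)"
            using zero_notin_row_word[of A i] sub by auto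
          then show ?thesis by (metis count_eq_zero_iff set_mset_mset)
        next
          case (Suc j)
          then show ?thesis using sub i
            by (auto simp: count_row_word A_def not_less intro!: sym[OF iffD2[OF count_eq_zero_iff]])
        qed
      qed
    qed (use dec i sorted_row_word in auto)
    have rows: "map (row_word A) [0..<dim_row A] = bs"
      by (rule nth_equalityI) (auto simp: A_def row[unfolded A_def])
    then have word: "reading_word A = v" using bs(1) by (simp add: reading_word_def)
    have "row_sums A = Delta n S" using map_length_row_words[of A] rows bs(2) by simp
    moreover have "\<exists>i<dim_row A. A $$ (i, j) \<noteq> 0" if "j < dim_col A" for j
      using Suc_in_reading_word_iff[of j A] that k word by (simp add: A_def)
    ultimately have "A \<in> Mat_at n S" by (simp add: Mat_at_iff)
    with word show ?thesis by blast
  qed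
  ultimately show "reading_word ` Mat_at n S = ?W" by blast
qed

text \<open>
  The entries of row \<open>i\<close> are the multiplicities in a weakly decreasing block, and such a block
  decreases strictly iff no letter is repeated.
\<close>

lemma entries01_iff:
  assumes A: "A \<in> Mat_at n S"
  shows "elements_mat A \<subseteq> {0, 1} \<longleftrightarrow> {1..n - 1} - S \<subseteq> strict_descents (reading_word A)"
proof -
  have row: "sorted_wrt (>) (row_word A i) \<longleftrightarrow> (\<forall>j<dim_col A. A $$ (i, j) \<le> 1)" for i
  proof -
    have "distinct (row_word A i) \<longleftrightarrow> (\<forall>j. count (mset (row_word A i)) (Suc j) \<le> 1)"
      unfolding distinct_iff_count_le
    proof (intro iffI allI)
      fix x assume *: "\<forall>j. count (mset (row_word A i)) (Suc j) \<le> 1"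
      show "count (mset (row_word A i)) x \<le> 1"
        using * zero_notin_row_word[of A i] by (cases x) (auto simp: count_eq_zero_iff[THEN iffD2])
    qed simp
    then show ?thesis
      by (auto simp: strictly_decreasing_iff sorted_row_word count_row_word)
  qed
  have "elements_mat A \<subseteq> {0, 1} \<longleftrightarrow> (\<forall>i<dim_row A. sorted_wrt (>) (row_word A i))"
    unfolding row by (force simp: elements_mat_def le_Suc_eq)
  also have "\<dots> \<longleftrightarrow> {1..n - 1} - S \<subseteq> strict_descents (reading_word A)"
    using sorted_rows_iff[OF A, of "(>)"] length_reading_word[OF A]
    by (auto simp: strict_descents_def transp_def)
  finally show ?thesis .
qed

text \<open>
  The sum of column \<open>j\<close> is the multiplicity of the letter \<open>Suc j\<close> in the whole word.
\<close>

lemma column_sums_1_iff: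
  assumes A: "A \<in> Mat_at n S"
  shows "(\<forall>j<dim_col A. (\<Sum>i<dim_row A. A $$ (i, j)) = 1) \<longleftrightarrow> reading_word A \<in> Sym n"
proof -
  have set: "set (reading_word A) = {1..dim_col A}"
    using A by (intro set_reading_word) (auto simp: Mat_at_iff)
  have "(\<forall>j<dim_col A. (\<Sum>i<dim_row A. A $$ (i, j)) = 1) \<longleftrightarrow>
      (\<forall>j<dim_col A. count (mset (reading_word A)) (Suc j) = 1)"
    by (simp add: count_reading_word)
  also have "\<dots> \<longleftrightarrow> (\<forall>x\<in>set (reading_word A). count (mset (reading_word A)) x = 1)"
    unfolding set image_Suc_lessThan[symmetric] by auto
  also have "\<dots> \<longleftrightarrow> distinct (reading_word A)"
    unfolding distinct_count_atmost_1 by (metis count_eq_zero_iff set_mset_mset)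
  also have "\<dots> \<longleftrightarrow> reading_word A \<in> Sym n"
    using set length_reading_word[OF A] distinct_card[of "reading_word A"]
    by (auto simp: Sym_def permutations_of_set_def)
  finally show ?thesis .
qed

lemma card_Mat_at:
  "card (Mat_at n S) = card {v \<in> Cay n. {1..n - 1} - S \<subseteq> weak_descents v}"
  by (rule bij_betw_same_card[OF bij_betw_reading_word])

lemma card_matrices_with:
  assumes "\<And>A. A \<in> Mat_at n S \<Longrightarrow> P A \<longleftrightarrow> Q (reading_word A)"
  shows "card {A \<in> Mat_at n S. P A} =
    card {v \<in> Cay n. {1..n - 1} - S \<subseteq> weak_descents v \<and> Q v}"
proof (rule bij_betw_same_card[of reading_word], rule bij_betw_subset[OF bij_betw_reading_word])
  have "reading_word ` {A \<in> Mat_at n S. P A} = {v \<in> reading_word ` Mat_at n S. Q v}"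
    using assms by auto
  also have "\<dots> = {v \<in> Cay n. {1..n - 1} - S \<subseteq> weak_descents v \<and> Q v}"
    unfolding bij_betw_imp_surj_on[OF bij_betw_reading_word] by simp
  finally show "reading_word ` {A \<in> Mat_at n S. P A} =
    {v \<in> Cay n. {1..n - 1} - S \<subseteq> weak_descents v \<and> Q v}" .
qed auto

end

theorem theorem8p2:
  fixes n :: nat and S :: "nat set"
  assumes "n \<ge> 1" and "S \<subseteq> {1..n - 1}"
  shows "(kappa_strict n S = card (Bur_at n S) \<and> card (Bur_at n S) = card (Mat_at n S)) \<and>
      (kappa n S = card (Bur01_at n S) \<and> card (Bur01_at n S) = card (Mat01_at n S)) \<and>
      (alpha n S = card (BurSym_at n S) \<and> card (BurSym_at n S) = card (MatSym_at n S))"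
proof -
  interpret cut_set n S using assms by unfold_locales
  have card_Pair: "card (Pair u ` X) = card X" for u :: "nat list" and X :: "nat list set"
    by (rule card_image) (simp add: inj_on_def)
  have lenC: "length v = n" if "v \<in> Cay n" for v using that by (simp add: Cay_def)
  have lenS: "length v = n" "distinct v" if "v \<in> Sym n" for v
    using that Sym_subset_Cay lenC by (auto simp: Sym_def permutations_of_set_def)
  have "kappa_strict n S = card {v \<in> Cay n. {1..n - 1} - S \<subseteq> weak_descents v}"
    unfolding kappa_strict_def
    by (rule arg_cong[of _ _ card]) (use lenC strict_ascents_subset_iff in blast)
  moreover have "kappa n S = card {v \<in> Cay n. {1..n - 1} - S \<subseteq> strict_descents v}"
    unfolding kappa_def
    by (rule arg_cong[of _ _ card]) (use lenC weak_ascents_subset_iff in blast)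
  moreover have "alpha n S = card {v \<in> Sym n. {1..n - 1} - S \<subseteq> weak_descents v}"
    unfolding alpha_def
    by (intro arg_cong[of _ _ card] Collect_cong conj_cong refl)
      (simp add: lenS weak_ascents_subset_iff weak_descents_distinct)
  moreover have "card (Mat01_at n S) = card {v \<in> Cay n. {1..n - 1} - S \<subseteq> strict_descents v}"
  proof -
    have "card (Mat01_at n S) = card {v \<in> Cay n. {1..n - 1} - S \<subseteq> weak_descents v \<and>
        {1..n - 1} - S \<subseteq> strict_descents v}"
      unfolding Mat01_at_def by (rule card_matrices_with) (rule entries01_iff)
    also have "\<dots> = card {v \<in> Cay n. {1..n - 1} - S \<subseteq> strict_descents v}"
      by (rule arg_cong[of _ _ card]) (use strict_subset_weak_descents in blast)
    finally show ?thesis .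
  qed
  moreover have "card (MatSym_at n S) = card {v \<in> Sym n. {1..n - 1} - S \<subseteq> weak_descents v}"
  proof -
    have "card (MatSym_at n S) =
        card {v \<in> Cay n. {1..n - 1} - S \<subseteq> weak_descents v \<and> v \<in> Sym n}"
      unfolding MatSym_at_def by (rule card_matrices_with) (rule column_sums_1_iff)
    also have "\<dots> = card {v \<in> Sym n. {1..n - 1} - S \<subseteq> weak_descents v}"
      by (rule arg_cong[of _ _ card]) (use Sym_subset_Cay in blast)
    finally show ?thesis .
  qed
  ultimately show ?thesis
    by (simp add: Bur_at_eq Bur01_at_eq BurSym_at_eq card_Pair card_Mat_at)
qed

end
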